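(* Let $X$ and $Y$ be Polish spaces, $\mu\in\mathcal{P}(X)$, $\nu\in\mathcal{P}(Y)$, and $c\colon X\times Y\to\mathbb{R}_+$ continuous with $T_c(\mu,\nu)<\infty$. Let $\pi\in\mathcal{C}(\mu,\nu)$ be optimal and $f\in S_c(\mu,\nu)$. If $\pi$ induces regularity on the relatively open set $U\subset\mathrm{supp}\,\mu$ with respect to the compact set $K\subset\mathrm{supp}\,\nu$, then $U\subset p_X(\mathrm{supp}\,\pi)$ and $$f(x)=\inf_{y\in K}c(x,y)-f^c(y)$$ for all $x\in U$. In particular, $f|_{\mathrm{supp}\,\mu}$ is continuous on $U$.
   Context: $\mathcal{P}(X)$ is the set of Borel probability measures; $\mathcal{C}(\mu,\nu)$ is the set of probability measures on $X\times Y$ with marginals $\mu,\nu$; $T_c(\mu,\nu)=\inf_{\pi\in\mathcal{C}(\mu,\nu)}\int c\,\mathrm{d}\pi$, and $\pi$ is optimal if it attains the infimum. $\mathrm{supp}$ is the smallest closed set of full measure; $p_X\colon X\times Y\to X$ is the projection. For $g\colon Y\to\mathbb{R}\cup\{-\infty\}$ set $g^c(x)=\inf_{y\in Y}c(x,y)-g(y)$, and for $f\colon X\to\mathbb{R}\cup\{-\infty\}$ set $f^c(y)=\inf_{x\in X}c(x,y)-f(x)$. A function $f\colon X\to\mathbb{R}\cup\{-\infty\}$ is $c$-concave on $X$ if $f=g^c$ for some $g\colon Y\to\mathbb{R}\cup\{-\infty\}$ and $f\not\equiv-\infty$. $S_c(\mu,\nu)$ (Kantorovich potentials) is the set of $c$-concave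 $f$ with $T_c(\mu,\nu)=\int c\,\mathrm{d}\pi=\int(f(x)+f^c(y))\,\mathrm{d}\pi(x,y)$ for an optimal plan $\pi$ (equivalently, every optimal plan). A plan $\pi\in\mathcal{C}(\mu,\nu)$ induces regularity on a relatively open set $U\subset\mathrm{supp}\,\mu$ with respect to a compact set $K\subset\mathrm{supp}\,\nu$ if $p_X(\mathrm{supp}\,\pi)\cap U=p_X\big(\mathrm{supp}\,\pi\cap(U\times K)\big)$. *)

theory Defs
  imports "HOL-Probability.Probability"
begin

definition borel_probabilities :: "'a::topological_space measure set" where
  "borel_probabilities = {\<mu>. prob_space \<mu> \<and> sets \<mu> = sets borel}"

definition couplings ::
  "'a::topological_space measure \<Rightarrow> 'b::topological_space measure \<Rightarrow> ('a \<times> 'b) measure set" where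
  "couplings \<mu> \<nu> =
     {\<pi> \<in> borel_probabilities. distr \<pi> borel fst = \<mu> \<and> distr \<pi> borel snd = \<nu>}"

text \<open>Costs are real-valued and, wherever the transport cost is used, nonnegative;
  \<^const>\<open>ennreal\<close> would truncate negative values to \<open>0\<close>.\<close>

definition transport_cost ::
  "('a::topological_space \<times> 'b::topological_space \<Rightarrow> real) \<Rightarrow> 'a measure \<Rightarrow> 'b measure \<Rightarrow> ennreal" where
  "transport_cost c \<mu> \<nu> = (INF \<pi>\<in>couplings \<mu> \<nu>. \<integral>\<^sup>+ z. ennreal (c z) \<partial>\<pi>)"

definition optimal_plans ::
  "('a::topological_space \<times> 'b::topological_space \<Rightarrow> real) \<Rightarrow> 'a measure \<Rightarrow> 'b measure
     \<Rightarrow> ('a \<times> 'b) measure set" where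
  "optimal_plans c \<mu> \<nu> =
     {\<pi> \<in> couplings \<mu> \<nu>. (\<integral>\<^sup>+ z. ennreal (c z) \<partial>\<pi>) = transport_cost c \<mu> \<nu>}"

text \<open>On a second countable space (hence on the Polish spaces considered here) this
  intersection is itself a closed set of full measure, so it is the smallest such set.\<close>

definition msupport :: "'a::topological_space measure \<Rightarrow> 'a set" where
  "msupport \<mu> = \<Inter>{C. closed C \<and> emeasure \<mu> (space \<mu> - C) = 0}"

text \<open>Functions into \<open>\<real> \<union> {-\<infinity>}\<close> are \<^typ>\<open>ereal\<close>-valued functions avoiding \<open>\<infinity>\<close>. As the cost
  is real-valued, the differences below are never of the form \<open>\<infinity> - \<infinity>\<close>.\<close>

definition ctransform_X ::
  "('a \<times> 'b \<Rightarrow> real) \<Rightarrow> ('b \<Rightarrow> ereal) \<Rightarrow> 'a \<Rightarrow> ereal" where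
  "ctransform_X c g x = (INF y. ereal (c (x, y)) - g y)"

definition ctransform_Y ::
  "('a \<times> 'b \<Rightarrow> real) \<Rightarrow> ('a \<Rightarrow> ereal) \<Rightarrow> 'b \<Rightarrow> ereal" where
  "ctransform_Y c f y = (INF x. ereal (c (x, y)) - f x)"

definition c_concave :: "('a \<times> 'b \<Rightarrow> real) \<Rightarrow> ('a \<Rightarrow> ereal) \<Rightarrow> bool" where
  "c_concave c f \<longleftrightarrow>
     (\<forall>x. f x \<noteq> \<infinity>) \<and> (\<exists>x. f x \<noteq> -\<infinity>) \<and>
     (\<exists>g. (\<forall>y. g y \<noteq> \<infinity>) \<and> f = ctransform_X c g)"

text \<open>Integral of the positive part minus integral of the negative part
  (\<^const>\<open>e2ennreal\<close> maps negative numbers to \<open>0\<close>). If both parts are infinite the value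
  is the junk value \<open>\<infinity>\<close>; a finite value therefore always is the genuine integral.\<close>

definition ereal_integral :: "'a measure \<Rightarrow> ('a \<Rightarrow> ereal) \<Rightarrow> ereal" where
  "ereal_integral M h =
     enn2ereal (\<integral>\<^sup>+ z. e2ennreal (h z) \<partial>M) - enn2ereal (\<integral>\<^sup>+ z. e2ennreal (- h z) \<partial>M)"

text \<open>For \<open>c\<close>-concave \<open>f\<close> neither \<open>f\<close> nor its transform takes the value \<open>\<infinity>\<close>, so the sum is
  well defined.\<close>

definition kantorovich_potentials ::
  "('a::topological_space \<times> 'b::topological_space \<Rightarrow> real) \<Rightarrow> 'a measure \<Rightarrow> 'b measure
     \<Rightarrow> ('a \<Rightarrow> ereal) set" where
  "kantorovich_potentials c \<mu> \<nu> =
     {f. c_concave c f \<and>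
         (\<exists>\<pi>\<in>optimal_plans c \<mu> \<nu>.
            enn2ereal (transport_cost c \<mu> \<nu>) =
              ereal_integral \<pi> (\<lambda>(x, y). f x + ctransform_Y c f y))}"

definition induces_regularity ::
  "('a::topological_space \<times> 'b::topological_space) measure \<Rightarrow> 'a set \<Rightarrow> 'b set \<Rightarrow> bool" where
  "induces_regularity \<pi> U K \<longleftrightarrow>
     fst ` msupport \<pi> \<inter> U = fst ` (msupport \<pi> \<inter> (U \<times> K))"

end

theory Submission
  imports Defs
begin

text \<open>The heart of the matter is that \<open>f x + f\<^sup>c y = c (x, y)\<close> holds almost everywhere for
  \<^emph>\<open>every\<close> optimal plan, although neither \<open>f\<close> nor its transform need be integrable. Truncate
  both at levels \<open>-n\<close> and \<open>n\<close>: the truncated sum stays below \<open>c\<close>, and its integral depends on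
  the marginals only. Hence the integral of \<open>c\<close> minus the truncated sum is the same for all
  optimal plans; it tends to \<open>0\<close> for the plan defining \<open>f\<close> as a potential, and Fatou's lemma
  transfers this to any other plan. As \<open>f\<close> and its transform are upper semicontinuous, equality
  extends to the support of the plan. Finally, projecting along the compact set \<open>K\<close> is a closed
  map, which yields in turn that \<open>K\<close> serves all of \<open>U\<close> and that \<open>f\<close> is lower semicontinuous there.\<close>

section \<open>Supports\<close>

text \<open>Complements turn the intersection of closed sets of full measure into the union of the
  open null sets.\<close>

lemma in_msupport_iff:
  fixes M :: "'a::topological_space measure"
  assumes "sets M = sets borel"
  shows "x \<in> msupport M \<longleftrightarrow> (\<forall>V. open V \<longrightarrow> x \<in> V \<longrightarrow> emeasure M V \<noteq> 0)"
proof -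
  have sp: "space M = UNIV"
    using sets_eq_imp_space_eq[OF assms] by simp
  have "x \<in> msupport M \<longleftrightarrow> (\<forall>C. closed C \<longrightarrow> emeasure M (- C) = 0 \<longrightarrow> x \<in> C)"
    unfolding msupport_def sp Compl_eq_Diff_UNIV by auto
  also have "\<dots> \<longleftrightarrow> (\<forall>V. open V \<longrightarrow> emeasure M V = 0 \<longrightarrow> x \<notin> V)"
    by (metis ComplD ComplI closed_def double_complement)
  finally show ?thesis by blast
qed

lemma closed_msupport: "closed (msupport M)"
  unfolding msupport_def by auto

text \<open>The complement is the union of all open null sets, which the Lindelof property reduces
  to a countable union.\<close>

lemma emeasure_Compl_msupport:
  fixes M :: "'a::second_countable_topology measure"
  assumes "sets M = sets borel"
  shows "emeasure M (- msupport M) = 0"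
proof -
  let ?N = "{V. open V \<and> emeasure M V = 0}"
  have "- msupport M = \<Union>?N"
    by (auto simp: in_msupport_iff[OF assms])
  moreover obtain F where F: "F \<subseteq> ?N" "countable F" "\<Union>F = \<Union>?N"
    using Lindelof[of ?N] by blast
  moreover have "(\<Union>V\<in>F. V) \<in> null_sets M"
    using F(1) assms by (intro null_sets_UN'[OF F(2)]) (auto simp: null_sets_def)
  ultimately show ?thesis by (simp add: null_sets_def)
qed

lemma open_meets_msupport:
  fixes M :: "'a::second_countable_topology measure"
  assumes "sets M = sets borel" "open V" "emeasure M V \<noteq> 0"
  shows "V \<inter> msupport M \<noteq> {}"
proof
  assume "V \<inter> msupport M = {}"
  then have "emeasure M V \<le> emeasure M (- msupport M)"
    using assms closed_msupport[of M] by (intro emeasure_mono) (auto simp: open_Compl)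
  with emeasure_Compl_msupport[OF assms(1)] assms(3) show False by simp
qed

text \<open>Serves to pass from an almost everywhere statement to every point of the support, once
  the condition is known to be closed.\<close>

lemma msupport_subset_closed:
  fixes M :: "'a::topological_space measure"
  assumes "sets M = sets borel" "closed C" "AE x in M. x \<in> C"
  shows "msupport M \<subseteq> C"
proof -
  have sp: "space M = UNIV"
    using sets_eq_imp_space_eq[OF assms(1)] by simp
  have "emeasure M (space M - C) = 0"
    using assms by (subst AE_iff_measurable[symmetric, where P = "\<lambda>x. x \<in> C"]) (auto simp: sp)
  with assms(2) show ?thesis unfolding msupport_def by blast
qed

section \<open>Couplings\<close>

lemma measurable_fst_borel [measurable]:
  "fst \<in> borel \<rightarrow>\<^sub>M (borel :: 'a::topological_space measure)"
  by (intro borel_measurable_continuous_onI continuous_intros)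

lemma measurable_snd_borel [measurable]:
  "snd \<in> borel \<rightarrow>\<^sub>M (borel :: 'a::topological_space measure)"
  by (intro borel_measurable_continuous_onI continuous_intros)

lemma couplingsD:
  assumes "\<pi> \<in> couplings \<mu> \<nu>"
  shows "prob_space \<pi>" "sets \<pi> = sets borel" "distr \<pi> borel fst = \<mu>" "distr \<pi> borel snd = \<nu>"
  using assms by (auto simp: couplings_def borel_probabilities_def)

lemma emeasure_cylinder:
  assumes "\<pi> \<in> couplings \<mu> \<nu>" "open V"
  shows "emeasure \<pi> (V \<times> UNIV) = emeasure \<mu> V"
proof -
  have [measurable_cong]: "sets \<pi> = sets borel" and sp: "space \<pi> = UNIV"
    using couplingsD[OF assms(1)] sets_eq_imp_space_eq[of \<pi> borel] by auto
  have "emeasure (distr \<pi> borel fst) V = emeasure \<pi> (fst -` V \<inter> space \<pi>)"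
    using assms(2) by (intro emeasure_distr) measurable
  with couplingsD[OF assms(1)] show ?thesis
    by (simp add: sp fst_vimage_eq_Times)
qed

text \<open>If \<open>V\<close> is a neighbourhood of \<open>fst z\<close>, then
  \<open>V \<times> UNIV\<close> is one of \<open>z\<close>, and its \<open>\<pi>\<close>-mass is
  the \<open>\<mu>\<close>-mass of \<open>V\<close>.\<close>

lemma fst_msupport_coupling:
  assumes "\<pi> \<in> couplings \<mu> \<nu>" "sets \<mu> = sets borel" "z \<in> msupport \<pi>"
  shows "fst z \<in> msupport \<mu>"
proof (unfold in_msupport_iff[OF assms(2)], intro allI impI)
  fix V assume V: "open V" "fst z \<in> V"
  then have "open (V \<times> UNIV)" "z \<in> V \<times> UNIV"
    by (auto intro: open_Times simp: mem_Times_iff)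
  then show "emeasure \<mu> V \<noteq> 0"
    using assms(3) emeasure_cylinder[OF assms(1) V(1)]
    unfolding in_msupport_iff[OF couplingsD(2)[OF assms(1)]] by metis
qed

text \<open>Over a convergent sequence of projected points, the second coordinates stay in
  \<open>K\<close> and converge along a subsequence; closedness of \<open>C\<close> keeps the limit
  pair in \<open>C\<close>.\<close>

lemma closed_fst_image_compact:
  fixes K :: "'b::metric_space set" and C :: "('a::metric_space \<times> 'b) set"
  assumes "closed C" "compact K"
  shows "closed (fst ` (C \<inter> UNIV \<times> K))"
proof (unfold closed_sequential_limits, intro allI impI, elim conjE)
  fix s x assume s: "\<forall>n. s n \<in> fst ` (C \<inter> UNIV \<times> K)" "s \<longlonglongrightarrow> x"
  then have "\<forall>n. \<exists>y\<in>K. (s n, y) \<in> C" by force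
  then obtain t where t: "\<And>n. t n \<in> K" "\<And>n. (s n, t n) \<in> C" by metis
  obtain y r where y: "y \<in> K" and r: "strict_mono r" "(t \<circ> r) \<longlonglongrightarrow> y"
    using \<open>compact K\<close> t(1) unfolding compact_def by metis
  have lim: "(\<lambda>n. ((s \<circ> r) n, (t \<circ> r) n)) \<longlonglongrightarrow> (x, y)"
    using LIMSEQ_subseq_LIMSEQ[OF s(2) r(1)] r(2) by (rule tendsto_Pair)
  have "(x, y) \<in> C"
    using t(2) by (intro closed_sequentially[OF assms(1) _ lim]) simp
  with y show "x \<in> fst ` (C \<inter> UNIV \<times> K)"
    by (intro image_eqI[of _ _ "(x, y)"]) auto
qed

text \<open>Regularity speaks only of points of \<open>U\<close> that already lie in the projected
  support. The projection \<open>?F\<close> of the part of the support over \<open>K\<close> is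
  closed, so a point of \<open>U\<close> outside it has a neighbourhood missing \<open>?F\<close>.
  Positive \<open>\<mu>\<close>-mass there forces a support point of \<open>\<pi>\<close> above it,
  whose first coordinate regularity puts into \<open>?F\<close>.\<close>

lemma regularity_attained:
  fixes \<mu> :: "'a::polish_space measure" and \<nu> :: "'b::polish_space measure"
  assumes \<pi>: "\<pi> \<in> couplings \<mu> \<nu>" and \<mu>: "sets \<mu> = sets borel"
    and U: "openin (top_of_set (msupport \<mu>)) U"
    and K: "compact K" and reg: "induces_regularity \<pi> U K"
    and x: "x \<in> U"
  shows "\<exists>y\<in>K. (x, y) \<in> msupport \<pi>"
proof (rule ccontr)
  let ?F = "fst ` (msupport \<pi> \<inter> UNIV \<times> K)"
  assume "\<not> ?thesis"
  then have "x \<notin> ?F" by auto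
  obtain V where V: "open V" "U = msupport \<mu> \<inter> V"
    using U unfolding openin_open by blast
  have op: "open (V - ?F)"
    using V(1) closed_fst_image_compact[OF closed_msupport K] by (rule open_Diff)
  have "emeasure \<mu> (V - ?F) \<noteq> 0"
    using in_msupport_iff[OF \<mu>] V x op \<open>x \<notin> ?F\<close> by blast
  then have "((V - ?F) \<times> UNIV) \<inter> msupport \<pi> \<noteq> {}"
    using op couplingsD(2)[OF \<pi>]
    by (intro open_meets_msupport) (auto simp: emeasure_cylinder[OF \<pi>] intro: open_Times)
  then obtain z where z: "z \<in> msupport \<pi>" "fst z \<in> V" "fst z \<notin> ?F" by auto
  moreover have "fst z \<in> U"
    using fst_msupport_coupling[OF \<pi> \<mu> z(1)] z(2) V by blast
  ultimately have "fst z \<in> fst ` (msupport \<pi> \<inter> (U \<times> K))"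
    using reg unfolding induces_regularity_def by blast
  with z(3) show False by blast
qed

section \<open>Upper semicontinuity\<close>

lemma open_INF_less:
  fixes h :: "'i \<Rightarrow> 'a::topological_space \<Rightarrow> ereal"
  assumes "\<And>i. continuous_on UNIV (h i)"
  shows "open {x. (INF i. h i x) < a}"
proof -
  have "{x. (INF i. h i x) < a} = (\<Union>i. {x. h i x < a})"
    by (auto simp: INF_less_iff)
  with assms show ?thesis
    by (auto intro!: open_UN open_Collect_less continuous_on_const)
qed

text \<open>For infinite \<open>e\<close> the difference is constant, since \<open>h\<close> is
  real-valued.\<close>

lemma continuous_on_ereal_minus_const:
  assumes "continuous_on S h"
  shows "continuous_on S (\<lambda>x. ereal (h x) - e)"
  using assms by (cases e) (auto intro!: continuous_intros)

lemma open_ctransform_X_less: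
  assumes "continuous_on UNIV c"
  shows "open {x. ctransform_X c g x < a}"
  unfolding ctransform_X_def
  by (intro open_INF_less continuous_on_ereal_minus_const continuous_on_compose2[OF assms])
     (auto intro!: continuous_intros)

lemma open_ctransform_Y_less:
  assumes "continuous_on UNIV c"
  shows "open {y. ctransform_Y c f y < a}"
  unfolding ctransform_Y_def
  by (intro open_INF_less continuous_on_ereal_minus_const continuous_on_compose2[OF assms])
     (auto intro!: continuous_intros)

lemma borel_measurable_usc:
  fixes f :: "'a::topological_space \<Rightarrow> ereal"
  assumes "\<And>a. open {x. f x < a}"
  shows "f \<in> borel_measurable borel"
  using assms by (intro borel_measurableI_less) auto

text \<open>Provides real levels for covering a strict sublevel set of a sum by rectangles.\<close>

lemma ereal_add_less_split:
  fixes u v :: ereal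
  assumes "u + v < ereal r" "u \<noteq> \<infinity>" "v \<noteq> \<infinity>"
  shows "\<exists>a b. u < ereal a \<and> v < ereal b \<and> a + b < r"
proof (cases "u = -\<infinity>")
  case True
  obtain b where "v < ereal b"
    using assms(3) by (metis ereal_infty_less(1) less_PInf_Ex_of_nat)
  \<comment> \<open>The level for \<open>u = -\<infinity>\<close> is free; it is chosen to make the
    two levels add up to \<open>r - 1\<close>.\<close>
  with True show ?thesis
    by (intro exI[of _ "r - b - 1"] exI[of _ b]) auto
next
  case False
  then obtain u' where u: "u = ereal u'" using assms(2) by (cases u) auto
  show ?thesis
  proof (cases v)
    case (real v')
    \<comment> \<open>Each summand is raised by a third of the positive slack
      \<open>r - u' - v'\<close>, so the last third keeps the inequality strict.\<close>
    then show ?thesis using assms(1) u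
      by (intro exI[of _ "u' + (r - u' - v') / 3"] exI[of _ "v' + (r - u' - v') / 3"])
         (auto simp: field_simps)
  next
    case MInf
    then show ?thesis using u
      by (intro exI[of _ "u' + 1"] exI[of _ "r - u' - 2"]) auto
  qed (use assms in auto)
qed

text \<open>The complement is a union of open sets: rectangles of sublevel sets at real levels
  \<open>a\<close> and \<open>b\<close>, cut with the open set where
  \<open>a + b < c z\<close>.\<close>

lemma closed_le_add_usc:
  fixes f :: "'a::topological_space \<Rightarrow> ereal" and g :: "'b::topological_space \<Rightarrow> ereal"
  assumes c: "continuous_on UNIV c"
    and f: "\<And>a. open {x. f x < a}" "\<And>x. f x \<noteq> \<infinity>"
    and g: "\<And>a. open {y. g y < a}" "\<And>y. g y \<noteq> \<infinity>"
  shows "closed {z. ereal (c z) \<le> f (fst z) + g (snd z)}"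
proof -
  have "- {z. ereal (c z) \<le> f (fst z) + g (snd z)}
      = (\<Union>a b. ({x. f x < ereal a} \<times> {y. g y < ereal b}) \<inter> {z. a + b < c z})"
    (is "?L = ?R")
  proof (intro equalityI subsetI)
    fix z assume "z \<in> ?L"
    then have "f (fst z) + g (snd z) < ereal (c z)" by auto
    from ereal_add_less_split[OF this f(2) g(2)] show "z \<in> ?R"
      by (auto simp: mem_Times_iff)
  next
    fix z assume "z \<in> ?R"
    then obtain a b where ab: "f (fst z) < ereal a" "g (snd z) < ereal b" "a + b < c z"
      by (auto simp: mem_Times_iff)
    have "f (fst z) + g (snd z) < ereal a + ereal b"
      using ab(1,2) by (rule ereal_add_strict_mono2)
    also have "\<dots> < ereal (c z)" using ab(3) by simp
    finally show "z \<in> ?L" by simp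
  qed
  moreover have "open ?R"
    by (intro open_UN ballI open_Int open_Times f g open_Collect_less continuous_on_const c)
  ultimately show ?thesis by (simp add: closed_def)
qed

section \<open>Truncation\<close>

text \<open>Clamping to \<open>[-n, n]\<close>. The result is real and bounded, so Bochner integrals
  and their additivity become available.\<close>

definition trunc :: "nat \<Rightarrow> ereal \<Rightarrow> real" where
  "trunc n u = real_of_ereal (max (ereal (- real n)) (min (ereal (real n)) u))"

lemma trunc_simps:
  "trunc n (ereal r) = max (- real n) (min (real n) r)"
  "trunc n \<infinity> = real n" "trunc n (-\<infinity>) = - real n"
  by (auto simp: trunc_def max_def min_def)

lemma trunc_bounded: "\<bar>trunc n u\<bar> \<le> real n"
  by (cases u) (auto simp: trunc_simps)

lemma borel_measurable_trunc [measurable]: "trunc n \<in> borel_measurable borel"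
  unfolding trunc_def[abs_def] by measurable

text \<open>Clipping from above only lowers the sum. If one summand is clipped from below to
  \<open>-n\<close>, the other is at most \<open>n\<close>, and the sum is at most
  \<open>0 \<le> r\<close>.\<close>

lemma trunc_add_le:
  assumes "u + v \<le> ereal r" "0 \<le> r" "u \<noteq> \<infinity>" "v \<noteq> \<infinity>"
  shows "trunc n u + trunc n v \<le> r"
  using assms by (cases u; cases v) (auto simp: trunc_simps)

text \<open>A real sum forces both summands to be finite; then \<open>u \<ge> - v\<close>, and
  \<open>trunc n\<close> is monotone and odd. Together with \<open>trunc_add_le\<close> this yields
  domination by the cost.\<close>

lemma trunc_add_nonneg:
  assumes "u + v = ereal r" "0 \<le> r"
  shows "0 \<le> trunc n u + trunc n v"
  using assms by (cases u; cases v) (auto simp: trunc_simps)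

lemma trunc_tendsto: "(\<lambda>n. ereal (trunc n u)) \<longlonglongrightarrow> u"
proof (cases u)
  case (real r)
  have "\<forall>\<^sub>F n in sequentially. \<bar>r\<bar> \<le> real n"
    using filterlim_real_sequentially by (auto simp: filterlim_at_top)
  then have "\<forall>\<^sub>F n in sequentially. ereal (trunc n u) = u"
    by eventually_elim (auto simp: real trunc_simps)
  then show ?thesis by (rule tendsto_eventually)
next
  case PInf
  then show ?thesis
    by (simp add: trunc_simps id_nat_ereal_tendsto_PInf)
next
  case MInf
  have "(\<lambda>n. - ereal (real n)) \<longlonglongrightarrow> - \<infinity>"
    using id_nat_ereal_tendsto_PInf by (subst ereal_Lim_uminus) simp
  with MInf show ?thesis by (simp add: trunc_simps)
qed

lemma trunc_add_tendsto:
  assumes "u \<noteq> \<infinity>" "v \<noteq> \<infinity>"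
  shows "(\<lambda>n. ereal (trunc n u + trunc n v)) \<longlonglongrightarrow> u + v"
proof -
  have "(\<lambda>n. ereal (trunc n u) + ereal (trunc n v)) \<longlonglongrightarrow> u + v"
    using assms by (intro tendsto_add_ereal_general trunc_tendsto) auto
  then show ?thesis by simp
qed

section \<open>Complementary slackness\<close>

text \<open>Boundedness lets the integral split, and each half is pushed forward to its marginal;
  the resulting value no longer mentions \<open>\<pi>\<close>.\<close>

lemma integral_trunc_coupling:
  assumes \<pi>: "\<pi> \<in> couplings \<mu> \<nu>"
    and [measurable]: "\<phi> \<in> borel_measurable borel" "\<psi> \<in> borel_measurable borel"
  shows "integrable \<pi> (\<lambda>z. trunc n (\<phi> (fst z)) + trunc n (\<psi> (snd z)))"
    and "(\<integral>z. trunc n (\<phi> (fst z)) + trunc n (\<psi> (snd z)) \<partial>\<pi>)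
       = (\<integral>x. trunc n (\<phi> x) \<partial>\<mu>) + (\<integral>y. trunc n (\<psi> y) \<partial>\<nu>)"
proof -
  interpret prob_space \<pi> using couplingsD[OF \<pi>] by blast
  have [measurable_cong]: "sets \<pi> = sets borel" using couplingsD[OF \<pi>] by blast
  have i1: "integrable \<pi> (\<lambda>z. trunc n (\<phi> (fst z)))"
    by (rule integrable_const_bound[where B = "real n"]) (auto simp: trunc_bounded)
  have i2: "integrable \<pi> (\<lambda>z. trunc n (\<psi> (snd z)))"
    by (rule integrable_const_bound[where B = "real n"]) (auto simp: trunc_bounded)
  show "integrable \<pi> (\<lambda>z. trunc n (\<phi> (fst z)) + trunc n (\<psi> (snd z)))"
    using i1 i2 by (rule Bochner_Integration.integrable_add)
  have "(\<integral>x. trunc n (\<phi> x) \<partial>distr \<pi> borel fst) = (\<integral>z. trunc n (\<phi> (fst z)) \<partial>\<pi>)"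
    by (rule integral_distr) measurable
  moreover have "(\<integral>y. trunc n (\<psi> y) \<partial>distr \<pi> borel snd) = (\<integral>z. trunc n (\<psi> (snd z)) \<partial>\<pi>)"
    by (rule integral_distr) measurable
  ultimately show "(\<integral>z. trunc n (\<phi> (fst z)) + trunc n (\<psi> (snd z)) \<partial>\<pi>)
       = (\<integral>x. trunc n (\<phi> x) \<partial>\<mu>) + (\<integral>y. trunc n (\<psi> y) \<partial>\<nu>)"
    using i1 i2 couplingsD[OF \<pi>] by simp
qed

lemma slackness_transfer:
  fixes \<pi> \<pi>' :: "('a::second_countable_topology \<times> 'b::second_countable_topology) measure"
  assumes \<pi>: "\<pi> \<in> couplings \<mu> \<nu>" and \<pi>': "\<pi>' \<in> couplings \<mu> \<nu>"
    and c [measurable]: "c \<in> borel_measurable borel" and c0: "\<And>z. 0 \<le> c z"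
    and fin: "(\<integral>\<^sup>+ z. ennreal (c z) \<partial>\<pi>) < \<infinity>"
    and eq: "(\<integral>\<^sup>+ z. ennreal (c z) \<partial>\<pi>) = (\<integral>\<^sup>+ z. ennreal (c z) \<partial>\<pi>')"
    and \<phi> [measurable]: "\<phi> \<in> borel_measurable borel" and \<phi>_fin: "\<And>x. \<phi> x \<noteq> \<infinity>"
    and \<psi> [measurable]: "\<psi> \<in> borel_measurable borel" and \<psi>_fin: "\<And>y. \<psi> y \<noteq> \<infinity>"
    and le: "\<And>z. \<phi> (fst z) + \<psi> (snd z) \<le> ereal (c z)"
    and AE': "AE z in \<pi>'. \<phi> (fst z) + \<psi> (snd z) = ereal (c z)"
  shows "AE z in \<pi>. ereal (c z) \<le> \<phi> (fst z) + \<psi> (snd z)"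
proof -
  have [measurable_cong]: "sets \<pi> = sets borel" "sets \<pi>' = sets borel"
    using couplingsD[OF \<pi>] couplingsD[OF \<pi>'] by auto
  have ic: "integrable \<pi> c" "integrable \<pi>' c"
    using fin eq c0 by (auto intro!: integrableI_nonneg)
  have ceq: "(\<integral>z. c z \<partial>\<pi>) = (\<integral>z. c z \<partial>\<pi>')"
    using c0 eq by (simp add: integral_eq_nn_integral)
  define s where "s n z = trunc n (\<phi> (fst z)) + trunc n (\<psi> (snd z))" for n z
  have [measurable]: "s n \<in> borel_measurable borel" for n
    unfolding s_def[abs_def] by measurable
  have int_s: "integrable \<pi> (s n)" "integrable \<pi>' (s n)" for n
    unfolding s_def[abs_def] using integral_trunc_coupling(1) \<pi> \<pi>' \<phi> \<psi> by blast+
  have seq: "(\<integral>z. s n z \<partial>\<pi>) = (\<integral>z. s n z \<partial>\<pi>')" for n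
    unfolding s_def[abs_def]
    using integral_trunc_coupling(2)[OF \<pi> \<phi> \<psi>] integral_trunc_coupling(2)[OF \<pi>' \<phi> \<psi>]
    by simp
  have s_le: "s n z \<le> c z" for n z
    unfolding s_def using le c0 \<phi>_fin \<psi>_fin by (intro trunc_add_le) auto
  have s_lim: "(\<lambda>n. ereal (s n z)) \<longlonglongrightarrow> \<phi> (fst z) + \<psi> (snd z)" for z
    unfolding s_def using \<phi>_fin \<psi>_fin by (intro trunc_add_tendsto) auto
  \<comment> \<open>Under \<open>\<pi>'\<close> the truncated sums lie between \<open>0\<close> and
    \<open>c\<close> almost everywhere, so \<open>c\<close> itself is an integrable
    majorant.\<close>
  have "(\<lambda>n. \<integral>z. s n z \<partial>\<pi>') \<longlonglongrightarrow> (\<integral>z. c z \<partial>\<pi>')"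
  proof (rule integral_dominated_convergence[where w = c])
    show "AE z in \<pi>'. (\<lambda>n. s n z) \<longlonglongrightarrow> c z"
      using AE'
    proof eventually_elim
      case (elim z)
      with s_lim[of z] show ?case by (simp add: lim_ereal)
    qed
    show "AE z in \<pi>'. norm (s n z) \<le> c z" for n
      using AE'
    proof eventually_elim
      case (elim z)
      then have "0 \<le> s n z"
        unfolding s_def using c0 by (intro trunc_add_nonneg)
      with s_le[of n z] show ?case by simp
    qed
  qed (use ic in measurable)
  \<comment> \<open>Both \<open>ceq\<close> and \<open>seq\<close> enter here: they identify the gap
    for \<open>\<pi>\<close> with the gap for \<open>\<pi>'\<close>.\<close>
  then have "(\<lambda>n. \<integral>z. c z - s n z \<partial>\<pi>) \<longlonglongrightarrow> 0"
    using tendsto_diff[OF tendsto_const, of _ "integral\<^sup>L \<pi>' c" _ "integral\<^sup>L \<pi>' c"]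
      ic int_s ceq seq by simp
  then have "(\<lambda>n. ennreal (\<integral>z. c z - s n z \<partial>\<pi>)) \<longlonglongrightarrow> 0"
    using tendsto_ennrealI by fastforce
  moreover have "ennreal (\<integral>z. c z - s n z \<partial>\<pi>) = (\<integral>\<^sup>+ z. ennreal (c z - s n z) \<partial>\<pi>)" for n
    using ic int_s s_le by (intro nn_integral_eq_integral[symmetric]) auto
  ultimately have lim0: "(\<lambda>n. \<integral>\<^sup>+ z. ennreal (c z - s n z) \<partial>\<pi>) \<longlonglongrightarrow> 0" by simp
  \<comment> \<open>Under \<open>\<pi>\<close> the gaps are known to be nonnegative, which is what
    Fatou's lemma asks for.\<close>
  have "(\<integral>\<^sup>+ z. liminf (\<lambda>n. ennreal (c z - s n z)) \<partial>\<pi>)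
      \<le> liminf (\<lambda>n. \<integral>\<^sup>+ z. ennreal (c z - s n z) \<partial>\<pi>)"
    by (rule nn_integral_liminf) measurable
  also have "\<dots> = 0"
    using lim0 by (intro lim_imp_Liminf) auto
  finally have "(\<integral>\<^sup>+ z. liminf (\<lambda>n. ennreal (c z - s n z)) \<partial>\<pi>) = 0" by simp
  then have "AE z in \<pi>. liminf (\<lambda>n. ennreal (c z - s n z)) = 0"
    by (subst (asm) nn_integral_0_iff_AE) measurable
  then show ?thesis
  proof eventually_elim
    case (elim z)
    show ?case
    proof (rule ccontr)
      assume "\<not> ?case"
      then have "\<phi> (fst z) + \<psi> (snd z) < ereal (c z)" by simp
      then obtain a where a: "\<phi> (fst z) + \<psi> (snd z) < ereal a" "a < c z"
        using ereal_dense2 by (metis less_ereal.simps(1))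
      \<comment> \<open>A strict inequality at \<open>z\<close> would keep all late gaps above the
        positive constant \<open>c z - a\<close>.\<close>
      have "\<forall>\<^sub>F n in sequentially. ennreal (c z - a) \<le> ennreal (c z - s n z)"
        using order_tendstoD(2)[OF s_lim a(1)] by eventually_elim (auto intro: ennreal_leI)
      then have "ennreal (c z - a) \<le> liminf (\<lambda>n. ennreal (c z - s n z))"
        by (rule Liminf_bounded)
      with elim a(2) show False by simp
    qed
  qed
qed

text \<open>The positive part of \<open>h\<close> is at most \<open>c\<close>, so
  \<open>?P \<le> ?C < \<infinity>\<close>; then \<open>?C = ?P - ?N\<close> leaves only
  \<open>?P = ?C\<close> and \<open>?N = 0\<close>. Finiteness of \<open>?C\<close> also excludes
  the junk value of \<open>ereal_integral\<close>.\<close>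

lemma AE_eq_if_ereal_integral_eq:
  assumes [measurable]: "h \<in> borel_measurable M" "c \<in> borel_measurable M"
    and le: "\<And>z. h z \<le> ereal (c z)"
    and fin: "(\<integral>\<^sup>+ z. ennreal (c z) \<partial>M) < \<infinity>"
    and eq: "enn2ereal (\<integral>\<^sup>+ z. ennreal (c z) \<partial>M) = ereal_integral M h"
    and c0: "\<And>z. 0 \<le> c z"
  shows "AE z in M. h z = ereal (c z)"
proof -
  let ?P = "\<integral>\<^sup>+ z. e2ennreal (h z) \<partial>M" and ?N = "\<integral>\<^sup>+ z. e2ennreal (- h z) \<partial>M"
  let ?C = "\<integral>\<^sup>+ z. ennreal (c z) \<partial>M"
  have hc: "e2ennreal (h z) \<le> ennreal (c z)" for z
    using le[of z] by (simp add: e2ennreal_mono ennreal.rep_eq flip: e2ennreal_ereal)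
  have PC: "?P \<le> ?C" by (intro nn_integral_mono hc)
  have "?P = ?C \<and> ?N = 0"
  proof -
    have "?C \<noteq> top" using fin by auto
    moreover from this have "?P \<noteq> top" using PC by (auto simp: top_unique)
    ultimately show ?thesis
      using eq PC unfolding ereal_integral_def
      by (cases ?C; cases ?P; cases ?N) (auto simp: enn2ereal_ennreal)
  qed
  then have PC_eq: "?P = ?C" and N0: "?N = 0" by auto
  have "(\<integral>\<^sup>+ z. ennreal (c z) - e2ennreal (h z) \<partial>M) = ?C - ?P"
    using PC fin by (intro nn_integral_diff) (auto simp: hc top_unique)
  also have "\<dots> = 0" using PC_eq fin by simp
  finally have "AE z in M. ennreal (c z) - e2ennreal (h z) = 0"
    by (subst (asm) nn_integral_0_iff_AE) measurable
  moreover have "AE z in M. e2ennreal (- h z) = 0"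
    using N0 by (subst (asm) nn_integral_0_iff_AE) measurable
  ultimately show ?thesis
  proof eventually_elim
    case (elim z)
    \<comment> \<open>Where \<open>c z = 0\<close>, equality of \<open>c\<close> with the positive
      part of \<open>h\<close> would still allow negative \<open>h z\<close>; the vanishing negative
      part rules this out.\<close>
    have "0 \<le> h z"
    proof (rule ccontr)
      assume "\<not> 0 \<le> h z"
      then have "0 < - h z" by (cases "h z") auto
      then have "enn2ereal (e2ennreal (- h z)) = - h z"
        by (intro enn2ereal_e2ennreal) simp
      with elim(2) \<open>0 < - h z\<close> show False by (simp add: zero_ennreal.rep_eq)
    qed
    moreover from elim(1) hc[of z] have "e2ennreal (h z) = ennreal (c z)"
      by (auto simp: diff_eq_0_iff_ennreal less_top[symmetric] intro: antisym)
    ultimately show ?case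
      using c0[of z] by (metis enn2ereal_e2ennreal enn2ereal_ennreal)
  qed
qed

section \<open>Kantorovich potentials\<close>

text \<open>A single point where \<open>f\<close> is finite bounds the infimum defining the
  transform. The value \<open>-\<infinity>\<close> remains possible for both functions.\<close>

lemma c_concave_transform_finite:
  assumes "c_concave c f"
  shows "f x \<noteq> \<infinity>" "ctransform_Y c f y \<noteq> \<infinity>"
proof -
  show "f x \<noteq> \<infinity>" using assms unfolding c_concave_def by blast
  obtain x0 where "f x0 \<noteq> -\<infinity>" "f x0 \<noteq> \<infinity>"
    using assms unfolding c_concave_def by blast
  then have "ereal (c (x0, y)) - f x0 < \<infinity>" by (cases "f x0") auto
  moreover have "ctransform_Y c f y \<le> ereal (c (x0, y)) - f x0"
    unfolding ctransform_Y_def by (rule INF_lower) simp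
  ultimately show "ctransform_Y c f y \<noteq> \<infinity>" by auto
qed

lemma fenchel_young:
  assumes "f x \<noteq> \<infinity>" "ctransform_Y c f y \<noteq> \<infinity>"
  shows "f x + ctransform_Y c f y \<le> ereal (c (x, y))"
proof -
  have "ctransform_Y c f y \<le> ereal (c (x, y)) - f x"
    unfolding ctransform_Y_def by (rule INF_lower) simp
  with assms show ?thesis
    by (cases "f x"; cases "ctransform_Y c f y") auto
qed

lemma potential_eq_on_support:
  fixes \<mu> :: "'a::second_countable_topology measure"
    and \<nu> :: "'b::second_countable_topology measure"
  assumes c: "continuous_on UNIV c" and c0: "\<And>z. 0 \<le> c z"
    and fin: "transport_cost c \<mu> \<nu> < \<infinity>"
    and \<pi>: "\<pi> \<in> optimal_plans c \<mu> \<nu>"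
    and f: "f \<in> kantorovich_potentials c \<mu> \<nu>"
    and xy: "(x, y) \<in> msupport \<pi>"
  shows "f x + ctransform_Y c f y = ereal (c (x, y))"
proof -
  let ?g = "ctransform_Y c f"
  from f obtain \<pi>' where conc: "c_concave c f" and \<pi>': "\<pi>' \<in> optimal_plans c \<mu> \<nu>"
    and eq: "enn2ereal (transport_cost c \<mu> \<nu>) = ereal_integral \<pi>' (\<lambda>(x, y). f x + ?g y)"
    unfolding kantorovich_potentials_def by blast
  have cpl: "\<pi> \<in> couplings \<mu> \<nu>" "\<pi>' \<in> couplings \<mu> \<nu>"
    and cost: "(\<integral>\<^sup>+ z. ennreal (c z) \<partial>\<pi>) = transport_cost c \<mu> \<nu>"
      "(\<integral>\<^sup>+ z. ennreal (c z) \<partial>\<pi>') = transport_cost c \<mu> \<nu>"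
    using \<pi> \<pi>' unfolding optimal_plans_def by auto
  have [measurable_cong]: "sets \<pi>' = sets borel" using couplingsD[OF cpl(2)] by blast
  \<comment> \<open>By c-concavity \<open>f\<close> is itself a transform, that is, an infimum of
    continuous functions.\<close>
  have f_usc: "open {x. f x < a}" for a
    using conc open_ctransform_X_less[OF c] unfolding c_concave_def by blast
  have g_usc: "open {y. ?g y < a}" for a by (rule open_ctransform_Y_less[OF c])
  have [measurable]: "c \<in> borel_measurable borel" "f \<in> borel_measurable borel"
      "?g \<in> borel_measurable borel"
    using borel_measurable_continuous_onI[OF c] f_usc g_usc
    by (auto intro: borel_measurable_usc)
  note nf = c_concave_transform_finite[OF conc]
  have le: "f (fst z) + ?g (snd z) \<le> ereal (c z)" for z
    using fenchel_young[of f "fst z" c "snd z"] nf by simp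
  \<comment> \<open>\<open>\<pi>'\<close> is the plan that witnesses \<open>f\<close> as a
    potential; it may differ from the given \<open>\<pi>\<close>.\<close>
  have "AE z in \<pi>'. f (fst z) + ?g (snd z) = ereal (c z)"
  proof (rule AE_eq_if_ereal_integral_eq)
    show "enn2ereal (\<integral>\<^sup>+ z. ennreal (c z) \<partial>\<pi>') =
        ereal_integral \<pi>' (\<lambda>z. f (fst z) + ?g (snd z))"
      using eq cost by (simp add: case_prod_unfold)
  qed (use le fin cost c0 in auto)
  then have "AE z in \<pi>. ereal (c z) \<le> f (fst z) + ?g (snd z)"
    using cost fin nf le c0 by (intro slackness_transfer[OF cpl]) auto
  then have "msupport \<pi> \<subseteq> {z. ereal (c z) \<le> f (fst z) + ?g (snd z)}"
    using couplingsD[OF cpl(1)] closed_le_add_usc[OF c f_usc nf(1) g_usc nf(2)]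
    by (intro msupport_subset_closed) auto
  with xy le[of "(x, y)"] show ?thesis by (auto intro: antisym)
qed

theorem lemma2:
  fixes \<mu> :: "'a::polish_space measure" and \<nu> :: "'b::polish_space measure"
    and c :: "'a \<times> 'b \<Rightarrow> real" and \<pi> :: "('a \<times> 'b) measure"
    and f :: "'a \<Rightarrow> ereal" and U :: "'a set" and K :: "'b set"
  assumes "\<mu> \<in> borel_probabilities" and "\<nu> \<in> borel_probabilities"
    and "continuous_on UNIV c" and "\<And>z. 0 \<le> c z"
    and "transport_cost c \<mu> \<nu> < \<infinity>"
    and "\<pi> \<in> optimal_plans c \<mu> \<nu>"
    and "f \<in> kantorovich_potentials c \<mu> \<nu>"
    and "openin (top_of_set (msupport \<mu>)) U"
    and "compact K" and "K \<subseteq> msupport \<nu>"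
    and "induces_regularity \<pi> U K"
  shows "U \<subseteq> fst ` msupport \<pi>
    \<and> (\<forall>x\<in>U. f x = (INF y\<in>K. ereal (c (x, y)) - ctransform_Y c f y))
    \<and> (\<forall>x\<in>U. continuous (at x within msupport \<mu>) f)"
proof -
  let ?g = "ctransform_Y c f"
  have conc: "c_concave c f"
    using assms(7) unfolding kantorovich_potentials_def by blast
  note nf = c_concave_transform_finite[OF conc]
  have \<pi>: "\<pi> \<in> couplings \<mu> \<nu>" using assms(6) unfolding optimal_plans_def by blast
  have \<mu>: "sets \<mu> = sets borel" using assms(1) unfolding borel_probabilities_def by blast
  have ex: "\<exists>y\<in>K. (x, y) \<in> msupport \<pi>" if "x \<in> U" for x
    using regularity_attained[OF \<pi> \<mu> assms(8,9,11) that] .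
  have upper: "f x \<le> ereal (c (x, y)) - ?g y" for x y
    using fenchel_young[of f x c y] nf(1)[of x] nf(2)[of y]
    by (cases "f x"; cases "?g y") auto
  \<comment> \<open>At a support point the sum \<open>f x + ?g y\<close> is real, so both terms are
    finite and \<open>?g y\<close> may be moved across.\<close>
  have attained: "\<exists>y\<in>K. f x = ereal (c (x, y)) - ?g y" if x: "x \<in> U" for x
  proof -
    obtain y where y: "y \<in> K" "(x, y) \<in> msupport \<pi>" using ex[OF x] by blast
    have "f x + ?g y = ereal (c (x, y))"
      using potential_eq_on_support[OF assms(3-7) y(2)] .
    then have "f x = ereal (c (x, y)) - ?g y"
      using nf(1)[of x] nf(2)[of y] by (cases "f x"; cases "?g y") auto
    with y(1) show ?thesis by blast
  qed
  have "U \<subseteq> fst ` msupport \<pi>" using ex by force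
  moreover have "f x = (INF y\<in>K. ereal (c (x, y)) - ?g y)" if x: "x \<in> U" for x
  proof (rule antisym)
    show "f x \<le> (INF y\<in>K. ereal (c (x, y)) - ?g y)" by (intro INF_greatest upper)
    obtain y where "y \<in> K" "f x = ereal (c (x, y)) - ?g y" using attained[OF x] by blast
    then show "(INF y\<in>K. ereal (c (x, y)) - ?g y) \<le> f x" by (intro INF_lower2[of y]) simp_all
  qed
  moreover have "continuous (at x within msupport \<mu>) f" if x: "x \<in> U" for x
    unfolding continuous_within
  proof (rule order_tendstoI)
    fix a assume a: "f x < a"
    have "open {x. f x < a}"
      using conc open_ctransform_X_less[OF assms(3)] unfolding c_concave_def by blast
    with a show "\<forall>\<^sub>F x in at x within msupport \<mu>. f x < a"
      unfolding eventually_at_topological by blast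
  next
    fix a assume a: "a < f x"
    then obtain r where r: "a < ereal r" "ereal r < f x" using ereal_dense2 by blast
    \<comment> \<open>As \<open>K\<close> is compact and the infimum is attained, this set is closed and cuts out
      the sublevel set of \<open>f\<close> in \<open>U\<close>.\<close>
    define S where "S = fst ` ({z. ereal (c z - r) \<le> 0 + ?g (snd z)} \<inter> UNIV \<times> K)"
    \<comment> \<open>Instance of \<open>closed_le_add_usc\<close> with cost \<open>c - r\<close>
      and the zero function in the first variable.\<close>
    have "closed {z. ereal (c z - r) \<le> (\<lambda>_. 0) (fst z) + ?g (snd z)}"
      using nf(2) open_ctransform_Y_less[OF assms(3)] assms(3)
      by (intro closed_le_add_usc continuous_intros) auto
    then have "closed S" unfolding S_def by (intro closed_fst_image_compact assms(9)) simp
    have S: "x' \<in> S \<longleftrightarrow> (\<exists>y\<in>K. ereal (c (x', y)) - ?g y \<le> ereal r)" for x'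
    proof -
      have "ereal (c (x', y) - r) \<le> 0 + ?g y \<longleftrightarrow> ereal (c (x', y)) - ?g y \<le> ereal r" for y
        using nf(2)[of y] by (cases "?g y") (auto simp: algebra_simps)
      then show ?thesis unfolding S_def by force
    qed
    \<comment> \<open>Every \<open>y\<close> gives a value of at least \<open>f x\<close>, which
      exceeds \<open>r\<close>.\<close>
    have "x \<notin> S" using S upper r(2) by (meson less_le_trans not_le)
    obtain V where V: "open V" "U = msupport \<mu> \<inter> V"
      using assms(8) unfolding openin_open by blast
    have "open (V - S)" "x \<in> V - S"
      using V x \<open>closed S\<close> \<open>x \<notin> S\<close> by (auto intro: open_Diff)
    moreover have "a < f x'" if "x' \<in> V - S" "x' \<in> msupport \<mu>" for x'
    proof -
      \<comment> \<open>Membership in \<open>U\<close> is what makes the infimum at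
        \<open>x'\<close> attained at some \<open>y\<close> in \<open>K\<close>; outside
        \<open>S\<close> that value exceeds \<open>r\<close>.\<close>
      have "x' \<in> U" using that V by blast
      then obtain y where "y \<in> K" "f x' = ereal (c (x', y)) - ?g y" using attained by blast
      with that(1) S have "ereal r < f x'" by (metis DiffD2 not_le)
      with r(1) show ?thesis by (rule less_trans)
    qed
    ultimately show "\<forall>\<^sub>F x in at x within msupport \<mu>. a < f x"
      unfolding eventually_at_topological by blast
  qed
  ultimately show ?thesis by blast
qed

end
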